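(* Let $q$ be a complex number with $|q|<1$. For all complex $t\ne0$ of sufficiently small modulus (depending on $q$), the generating function $G(t,q)$ of the $q$-tangent numbers is $$G(t,q)=\dfrac{(1+\lambda^2)\left[1-(1+\lambda^2)\sum\limits_{k=0}^{\infty}\dfrac{(-i\lambda)^k}{1-i\lambda q^{k}}\right]}{\lambda^2(1-q)}\,,$$ where $\lambda$ is the root of $\lambda^2-\lambda(1-q)/t+1=0$ with smallest modulus.
   Context: A Dyck path of length $2N$ is a lattice path from $(0,0)$ to $(2N,0)$ with $N$ steps $(1,1)$ and $N$ steps $(1,-1)$ that never goes below $y=0$. Its steps are labelled: $a_j$ is a step $(1,1)$ starting at height $j\ge 0$, and $b_k$ is a step $(1,-1)$ starting at height $k\ge1$. Thus a Dyck path is encoded as a word $u_1u_2\cdots u_{2N}$ in these labels. Given a possibility function $pos:\{a_0,a_1,\ldots\}\cup\{b_1,b_2,\ldots\}\to\mathbb{N}_0$, a path diagram is a Dyck path $u_1\cdots u_{2N}$ together with a sequence of integers $s_1,\ldots,s_{2N}$ with $0\le s_i\le pos(u_i)$ for all $i$. Here the possibility function is $pos(a_j)=j$ for $j\ge0$, $pos(b_k)=k$ for $k\ge1$. The generating function of unrestricted path diagrams is $$G(t,q)=\sum_{N,m\ge0}a_{N,m}t^{2N}q^m,$$ where $a_{N,m}$ is the number of such path diagrams whose Dyck path has length $2N$ (no restriction on height) and with $s_1+\cdots+s_{2N}=m$ (the empty path counts once for $N=m=0$). The coefficient $[t^{2N}]G(t,q)$ is the $q$-tangent number $E_{2N+1}(q)$.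 Here $i=\sqrt{-1}$. *)

theory Defs
  imports "HOL-Analysis.Analysis"
begin

datatype step = Up | Down

definition height :: "step list \<Rightarrow> nat \<Rightarrow> int" where
  "height p i = int (count_list (take i p) Up) - int (count_list (take i p) Down)"

definition dyck_path :: "nat \<Rightarrow> step list \<Rightarrow> bool" where
  "dyck_path N p \<longleftrightarrow>
     count_list p Up = N \<and> count_list p Down = N \<and> (\<forall>i\<le>length p. 0 \<le> height p i)"

text \<open>\<open>a_step j\<close> is an up step starting at height \<open>j\<close>, \<open>b_step k\<close> a down step starting at height \<open>k\<close>.
  The label \<open>b_step 0\<close> never occurs in a Dyck path.\<close>

datatype label = a_step nat | b_step nat

text \<open>Along a Dyck path all heights are nonnegative, so \<open>nat\<close> does not truncate.\<close>

definition labels :: "step list \<Rightarrow> label list" where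
  "labels p = map (\<lambda>i. case p ! i of Up \<Rightarrow> a_step (nat (height p i)) | Down \<Rightarrow> b_step (nat (height p i)))
                  [0..<length p]"

definition path_diagram :: "(label \<Rightarrow> nat) \<Rightarrow> nat \<Rightarrow> step list \<times> nat list \<Rightarrow> bool" where
  "path_diagram pos N = (\<lambda>(p, s). dyck_path N p \<and> length s = length p \<and>
     (\<forall>i<length p. s ! i \<le> pos (labels p ! i)))"

definition num_diagrams :: "(label \<Rightarrow> nat) \<Rightarrow> nat \<Rightarrow> nat \<Rightarrow> nat" where
  "num_diagrams pos N m = card {(p, s). path_diagram pos N (p, s) \<and> sum_list s = m}"

fun tangent_pos :: "label \<Rightarrow> nat" where
  "tangent_pos (a_step j) = j"
| "tangent_pos (b_step k) = k"

definition G_term :: "complex \<Rightarrow> complex \<Rightarrow> nat \<times> nat \<Rightarrow> complex" where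
  "G_term t q = (\<lambda>(N, m). of_nat (num_diagrams tangent_pos N m) * t ^ (2 * N) * q ^ m)"

text \<open>The value of the double series over all \<open>N, m \<ge> 0\<close>; it is meaningful only
  when \<open>G_term t q\<close> is summable.\<close>

definition G :: "complex \<Rightarrow> complex \<Rightarrow> complex" where
  "G t q = (\<Sum>\<^sub>\<infinity>x\<in>UNIV. G_term t q x)"

text \<open>Strict minimality among the roots makes the root of smallest modulus unique.\<close>

definition smallest_root :: "complex \<Rightarrow> complex \<Rightarrow> complex \<Rightarrow> bool" where
  "smallest_root t q l \<longleftrightarrow>
     l\<^sup>2 - l * (1 - q) / t + 1 = 0 \<and>
     (\<forall>l'. l'\<^sup>2 - l' * (1 - q) / t + 1 = 0 \<and> l' \<noteq> l \<longrightarrow> norm l < norm l')"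

end

theory Submission
  imports Defs
begin

text \<open>Let \<open>F\<^sub>h\<close> be the generating function, by length, of the diagrams that start at height \<open>h\<close>
  and end at height \<open>0\<close>. Splitting off the first step gives
  \<open>F\<^sub>h = \<delta>\<^bsub>h,0\<^esub> + t [h+1]\<^sub>q (F\<^bsub>h+1\<^esub> + F\<^bsub>h-1\<^esub>)\<close>, and for small \<open>t\<close> the right-hand side is a
  contraction of bounded sequences, so \<open>F\<close> is the only bounded solution.
  Looking for solutions of the form \<open>\<lambda>^h \<Sum>\<^sub>n c\<^sub>n q^(hn)\<close> leads to a \<open>\<^sub>2\<phi>\<^sub>1\<close> series with parameters
  \<open>i\<lambda>\<close>, \<open>-i\<lambda>\<close>, \<open>q\<lambda>\<^sup>2\<close>, which Heine's transformation and the \<open>q\<close>-Gauss sum turn into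
  \<open>F\<^sub>h = (1 + a) \<lambda>^(h+1) / t \<cdot> \<Sum>\<^sub>k (-a)^k \<Prod>\<^bsub>k<j\<le>k+h+1\<^esub> (1 - q^j) / (1 - a q^j)\<close>
  with \<open>a = i\<lambda>\<close>. That this bounded sequence solves the recurrence follows by telescoping over
  \<open>k\<close>, and \<open>F\<^sub>0\<close> rearranges to the claimed expression.\<close>

section \<open>Path diagrams from an arbitrary starting height\<close>

text \<open>With a free starting height, removing the first step leaves an object of the same kind.
  The test \<open>h \<noteq> 0\<close> keeps \<open>h - 1\<close> from truncating; the bound
  \<open>x \<le> h\<close> serves both steps because \<open>tangent_pos\<close> always returns the
  starting height.\<close>

fun diagram_from :: "nat \<Rightarrow> step list \<Rightarrow> nat list \<Rightarrow> bool" where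
  "diagram_from h [] [] \<longleftrightarrow> h = 0"
| "diagram_from h (Up # p) (x # s) \<longleftrightarrow> x \<le> h \<and> diagram_from (Suc h) p s"
| "diagram_from h (Down # p) (x # s) \<longleftrightarrow> x \<le> h \<and> h \<noteq> 0 \<and> diagram_from (h - 1) p s"
| "diagram_from h _ _ \<longleftrightarrow> False"

lemma height_0 [simp]: "height p 0 = 0"
  by (simp add: height_def)

lemma height_Cons_Suc [simp]:
  "height (u # p) (Suc i) = (case u of Up \<Rightarrow> 1 | Down \<Rightarrow> -1) + height p i"
  by (cases u) (simp_all add: height_def)

lemma diagram_from_iff:
  "diagram_from h p s \<longleftrightarrow>
     length s = length p \<and> int h + height p (length p) = 0 \<and>
     (\<forall>i\<le>length p. 0 \<le> int h + height p i) \<and>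
     (\<forall>i<length p. s ! i \<le> nat (int h + height p i))"
proof (induction h p s rule: diagram_from.induct)
  case (2 h p x s)
  have *: "int h + (1 + z) = int (Suc h) + z" for z by simp
  show ?case
    by (simp only: diagram_from.simps 2 length_Cons less_Suc_eq_le[symmetric] All_less_Suc2
        nth_Cons_0 nth_Cons_Suc height_0 height_Cons_Suc step.case * nat.inject) auto
next
  case (3 h p x s)
  show ?case
  proof (cases h)
    case 0
    \<comment> \<open>A down step from height 0 breaks nonnegativity at index 1, so both sides are
      false.\<close>
    then have "\<not> (\<forall>i\<le>length (Down # p). 0 \<le> int h + height (Down # p) i)"
      by (auto intro!: exI[of _ "Suc 0"])
    then show ?thesis using 0 by auto
  next
    case (Suc k)
    have *: "int (Suc k) + (-1 + z) = int k + z" for z by simp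
    have IH: "diagram_from k p s \<longleftrightarrow> length s = length p \<and> int k + height p (length p) = 0 \<and>
     (\<forall>i\<le>length p. 0 \<le> int k + height p i) \<and>
     (\<forall>i<length p. s ! i \<le> nat (int k + height p i))" using 3 Suc by simp
    show ?thesis unfolding Suc
      by (simp only: diagram_from.simps diff_Suc_1 IH length_Cons less_Suc_eq_le[symmetric] All_less_Suc2
          nth_Cons_0 nth_Cons_Suc height_0 height_Cons_Suc step.case * nat.inject) auto
  qed
qed auto

lemma count_list_steps: "count_list p Up + count_list p Down = length p"
proof (induction p)
  case (Cons u p)
  then show ?case by (cases u) auto
qed simp

lemma tangent_pos_labels:
  "i < length p \<Longrightarrow> tangent_pos (labels p ! i) = nat (height p i)"
  by (simp add: labels_def split: step.split)

text \<open>The two step counts add up to the length and their difference is the final height, so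
  requiring both to be \<open>N\<close> means length \<open>2 * N\<close> and final height
  0.\<close>

lemma path_diagram_iff:
  "path_diagram tangent_pos N (p, s) \<longleftrightarrow> length p = 2 * N \<and> diagram_from 0 p s"
proof -
  have "count_list p Up = N \<and> count_list p Down = N \<longleftrightarrow>
      length p = 2 * N \<and> height p (length p) = 0"
    using count_list_steps[of p] by (auto simp: height_def)
  then show ?thesis
    by (auto simp: path_diagram_def dyck_path_def diagram_from_iff tangent_pos_labels)
qed

definition diagrams :: "nat \<Rightarrow> nat \<Rightarrow> (step list \<times> nat list) set" where
  "diagrams n h = {(p, s). length p = n \<and> diagram_from h p s}"

lemma diagrams_0: "diagrams 0 h = (if h = 0 then {([], [])} else {})"
proof -
  have "diagram_from h [] s \<longleftrightarrow> h = 0 \<and> s = []" for s by (cases s) auto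
  then show ?thesis by (auto simp: diagrams_def)
qed

lemma diagrams_Suc:
  "diagrams (Suc n) h =
     (\<lambda>(x, p, s). (Up # p, x # s)) ` ({..h} \<times> diagrams n (Suc h)) \<union>
     (\<lambda>(x, p, s). (Down # p, x # s)) ` ({..h} \<times> (if h = 0 then {} else diagrams n (h - 1)))"
  (is "?L = ?R")
proof (intro set_eqI iffI)
  fix z assume "z \<in> ?L"
  then obtain p s where z: "z = (p, s)" "length p = Suc n" "diagram_from h p s"
    by (auto simp: diagrams_def)
  then obtain u p' where p: "p = u # p'" by (cases p) auto
  with z obtain x s' where s: "s = x # s'" by (cases s; cases u) auto
  show "z \<in> ?R"
    using z p s by (cases u) (force simp: diagrams_def image_iff)+
next
  fix z assume "z \<in> ?R"
  then show "z \<in> ?L" by (auto simp: diagrams_def split: if_splits)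
qed

lemma finite_diagrams: "finite (diagrams n h)"
  by (induction n arbitrary: h) (auto simp: diagrams_0 diagrams_Suc)

section \<open>Weight polynomials of diagrams of fixed length\<close>

text \<open>Polymorphic because it is evaluated both at the complex \<open>q\<close> and at the real
  \<open>norm q\<close>, the latter for absolute convergence.\<close>

fun weight :: "'a::comm_semiring_1 \<Rightarrow> nat \<Rightarrow> nat \<Rightarrow> 'a" where
  "weight q 0 h = (if h = 0 then 1 else 0)"
| "weight q (Suc n) h =
     (\<Sum>s\<le>h. q ^ s) * (weight q n (Suc h) + (if h = 0 then 0 else weight q n (h - 1)))"

text \<open>The integer attached to the first step ranges over \<open>{..h}\<close> independently of
  the rest, so its contribution factors out.\<close>

lemma sum_diagrams: "(\<Sum>(p, s)\<in>diagrams n h. q ^ sum_list s) = weight q n h"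
proof (induction n arbitrary: h)
  case 0
  then show ?case by (simp add: diagrams_0)
next
  case (Suc n)
  have *: "(\<Sum>(p, s)\<in>(\<lambda>(x, p, s). (u # p, x # s)) ` ({..h} \<times> D). q ^ sum_list s) =
      (\<Sum>s\<le>h. q ^ s) * (\<Sum>(p, s)\<in>D. q ^ sum_list s)"
    for u and D :: "(step list \<times> nat list) set"
    by (subst sum.reindex)
      (auto simp: inj_on_def sum_product sum.cartesian_product power_add intro!: sum.cong)
  show ?case
    unfolding diagrams_Suc
    by (subst sum.union_disjoint)
      (auto simp: * Suc distrib_left finite_diagrams)
qed

lemma num_diagrams_eq:
  "num_diagrams tangent_pos N m = card {x \<in> diagrams (2 * N) 0. sum_list (snd x) = m}"
  unfolding num_diagrams_def path_diagram_iff diagrams_def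
  by (rule arg_cong[where f = card]) auto

text \<open>There are finitely many diagrams of a given length; grouping them by their total gives a
  finite sum over \<open>m\<close>, and all other counts vanish.\<close>

lemma has_sum_num_diagrams:
  fixes q :: "'a::real_normed_field"
  shows "((\<lambda>m. of_nat (num_diagrams tangent_pos N m) * q ^ m) has_sum weight q (2 * N) 0) UNIV"
proof -
  let ?D = "diagrams (2 * N) 0"
  let ?f = "\<lambda>x :: step list \<times> nat list. sum_list (snd x)"
  have "weight q (2 * N) 0 = (\<Sum>x\<in>?D. q ^ ?f x)"
    by (subst sum_diagrams[symmetric]) (auto intro!: sum.cong)
  also have "\<dots> = (\<Sum>m\<in>?f ` ?D. \<Sum>x | x \<in> ?D \<and> ?f x = m. q ^ ?f x)"
    by (rule sum.image_gen[OF finite_diagrams])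
  also have "\<dots> = (\<Sum>m\<in>?f ` ?D. of_nat (num_diagrams tangent_pos N m) * q ^ m)"
    by (intro sum.cong refl) (simp add: num_diagrams_eq)
  finally have "((\<lambda>m. of_nat (num_diagrams tangent_pos N m) * q ^ m) has_sum weight q (2 * N) 0)
      (?f ` ?D)"
    by (simp add: finite_diagrams)
  moreover have "num_diagrams tangent_pos N m = 0" if "m \<notin> ?f ` ?D" for m
  proof -
    have "{x \<in> ?D. ?f x = m} = {}" using that by force
    then show ?thesis unfolding num_diagrams_eq by (simp only: card.empty)
  qed
  ultimately show ?thesis
    by (subst has_sum_cong_neutral[where T = "?f ` ?D"]) auto
qed

lemma weight_odd: "odd (n + h) \<Longrightarrow> weight q n h = 0"
  by (induction n arbitrary: h) (auto simp: odd_pos)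

section \<open>Bounds and the bounded solution of the recurrence\<close>

lemma norm_sum_powers_le:
  fixes q :: "'a::real_normed_field"
  assumes "norm q < 1"
  shows "norm (\<Sum>s\<le>h. q ^ s) \<le> 1 / (1 - norm q)"
proof -
  have "norm (\<Sum>s\<le>h. q ^ s) \<le> (\<Sum>s\<le>h. norm q ^ s)"
    by (rule order_trans[OF norm_sum]) (simp add: norm_power)
  also have "\<dots> \<le> (\<Sum>s. norm q ^ s)"
    using assms by (intro sum_le_suminf summable_geometric) auto
  also have "\<dots> = 1 / (1 - norm q)"
    using assms by (simp add: suminf_geometric)
  finally show ?thesis .
qed

lemma norm_weight_le:
  fixes q :: "'a::real_normed_field"
  assumes "norm q < 1"
  shows "norm (weight q n h) \<le> (2 / (1 - norm q)) ^ n"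
proof (induction n arbitrary: h)
  case (Suc n)
  let ?B = "(2 / (1 - norm q)) ^ n"
  have B: "?B \<ge> 0" using assms by simp
  have "norm (weight q n (Suc h) + (if h = 0 then 0 else weight q n (h - 1))) \<le> ?B + ?B"
    using Suc B by (intro norm_triangle_mono) auto
  then have "norm (weight q (Suc n) h) \<le> 1 / (1 - norm q) * (?B + ?B)"
    unfolding weight.simps norm_mult
    using norm_sum_powers_le[OF assms] assms by (intro mult_mono) auto
  then show ?case by (simp add: field_simps)
qed simp

text \<open>The remainder after \<open>M\<close> terms satisfies the recurrence without its
  inhomogeneous term, so every further term shrinks its uniform bound by a fixed factor.\<close>

lemma weight_sums_bounded_solution:
  fixes q t :: "'a::real_normed_field"
  assumes q: "norm q < 1" and t: "2 * norm t < 1 - norm q"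
    and B: "\<And>h. norm (f h) \<le> B"
    and f: "\<And>h. f h = (if h = 0 then 1 else 0) +
              t * (\<Sum>s\<le>h. q ^ s) * (f (Suc h) + (if h = 0 then 0 else f (h - 1)))"
  shows "(\<lambda>n. weight q n h * t ^ n) sums f h"
proof -
  \<comment> \<open>The contraction factor: two neighbouring heights, each weighted by at most
    \<open>norm t / (1 - norm q)\<close>.\<close>
  define c where "c = 2 * norm t / (1 - norm q)"
  have c: "0 \<le> c" "c < 1" using q t by (auto simp: c_def)
  have B0: "0 \<le> B" using B[of 0] norm_ge_zero order_trans by blast
  define R where "R M h = f h - (\<Sum>n<M. weight q n h * t ^ n)" for M h
  have R: "norm (R M h) \<le> B * c ^ M" for M h
  proof (induction M arbitrary: h)
    case 0
    then show ?case using B by (simp add: R_def)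
  next
    case (Suc M)
    define Q where "Q = (\<Sum>s\<le>h. q ^ s)"
    have "(\<Sum>n<Suc M. weight q n h * t ^ n) = (if h = 0 then 1 else 0) +
        t * Q * ((\<Sum>n<M. weight q n (Suc h) * t ^ n) +
          (if h = 0 then 0 else (\<Sum>n<M. weight q n (h - 1) * t ^ n)))"
      unfolding sum.lessThan_Suc_shift weight.simps Q_def[symmetric]
      by (simp add: sum_distrib_left sum.distrib algebra_simps)
    then have "R (Suc M) h =
        t * Q * (R M (Suc h) + (if h = 0 then 0 else R M (h - 1)))"
      unfolding R_def by (subst f) (simp add: Q_def[symmetric] algebra_simps)
    moreover have "norm (R M (Suc h) + (if h = 0 then 0 else R M (h - 1))) \<le> B * c ^ M + B * c ^ M"
      using Suc B0 c by (intro norm_triangle_mono) auto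
    moreover have "norm Q \<le> 1 / (1 - norm q)"
      unfolding Q_def by (rule norm_sum_powers_le[OF q])
    ultimately have "norm (R (Suc M) h) \<le> norm t * (1 / (1 - norm q)) * (B * c ^ M + B * c ^ M)"
      using q by (simp only: norm_mult) (intro mult_mono; simp)
    also have "\<dots> = B * c ^ Suc M" by (simp add: c_def)
    finally show ?case .
  qed
  have "(\<lambda>M. B * c ^ M) \<longlonglongrightarrow> B * 0"
    by (intro tendsto_intros LIMSEQ_power_zero) (use c in auto)
  then have lim: "(\<lambda>M. B * c ^ M) \<longlonglongrightarrow> 0"
    by (simp only: mult_zero_right)
  have "\<forall>\<^sub>F M in sequentially. norm (R M h) \<le> B * c ^ M"
    using R by (intro always_eventually allI)
  from this lim have "(\<lambda>M. R M h) \<longlonglongrightarrow> 0"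
    by (rule Lim_null_comparison)
  from tendsto_diff[OF tendsto_const[of "f h"] this] show ?thesis
    by (simp add: sums_def R_def)
qed


section \<open>Evaluation of the double series\<close>

text \<open>Replacing \<open>q\<close> and \<open>t\<close> by their norms gives the series of
  norms; its convergence justifies summing over \<open>m\<close> first.\<close>

lemma G_term_has_sum:
  fixes q t :: complex
  assumes q: "norm q < 1" and t: "2 * norm t < 1 - norm q"
    and sums: "(\<lambda>n. weight q n 0 * t ^ n) sums S"
  shows "G_term t q summable_on UNIV" and "G t q = S"
proof -
  define c where "c = 2 * norm t / (1 - norm q)"
  have c: "0 \<le> c" "c < 1" using q t by (auto simp: c_def)
  have le: "norm (weight q n 0) * norm t ^ n \<le> c ^ n"
    and le_norm: "norm (weight (norm q) n 0) * norm t ^ n \<le> c ^ n" for n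
    using mult_right_mono[OF norm_weight_le[of q n 0], of "norm t ^ n"]
      mult_right_mono[OF norm_weight_le[of "norm q" n 0], of "norm t ^ n"] q
    by (simp_all add: c_def power_divide power_mult_distrib)
  have c2: "summable (\<lambda>N. c ^ (2 * N))"
    using c by (simp add: power_mult power_less_one_iff abs_square_less_1)
  have inner: "((\<lambda>m. G_term t q (N, m)) has_sum weight q (2 * N) 0 * t ^ (2 * N)) UNIV" for N
    using has_sum_cmult_left[OF has_sum_num_diagrams[of N q], of "t ^ (2 * N)"]
    by (simp add: G_term_def mult_ac)
  have inner_norm: "((\<lambda>m. norm (G_term t q (N, m))) has_sum
      weight (norm q) (2 * N) 0 * norm t ^ (2 * N)) UNIV" for N
    using has_sum_cmult_left[OF has_sum_num_diagrams[of N "norm q"], of "norm t ^ (2 * N)"]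
    by (simp add: G_term_def mult_ac norm_mult norm_power)
  have "summable (\<lambda>N. norm (weight (norm q) (2 * N) 0 * norm t ^ (2 * N)))"
    using le_norm by (intro summable_comparison_test'[OF c2]) (simp add: abs_mult)
  then have "(\<lambda>N. norm (weight (norm q) (2 * N) 0 * norm t ^ (2 * N))) summable_on UNIV"
    by (intro norm_summable_imp_summable_on) simp
  then have abs: "(\<lambda>x. norm (G_term t q x)) summable_on (UNIV \<times> UNIV)"
    unfolding Infinite_Sum.abs_summable_on_Sigma_iff infsumI[OF inner_norm]
    using has_sum_imp_summable[OF inner_norm] by simp
  then show "G_term t q summable_on UNIV"
    by (simp add: abs_summable_summable)
  have "((\<lambda>N. weight q (2 * N) 0 * t ^ (2 * N)) has_sum S) UNIV"
  proof (rule norm_summable_imp_has_sum)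
    show "summable (\<lambda>N. norm (weight q (2 * N) 0 * t ^ (2 * N)))"
      using le by (intro summable_comparison_test'[OF c2]) (simp add: norm_mult norm_power)
    \<comment> \<open>Odd lengths contribute nothing, so the series over all lengths reindexes to
      even ones.\<close>
    have "weight q n 0 * t ^ n = 0" if "n \<notin> range (\<lambda>N. 2 * N)" for n
    proof -
      have "odd n" using that by (auto elim: evenE)
      then show ?thesis by (simp add: weight_odd)
    qed
    then show "(\<lambda>N. weight q (2 * N) 0 * t ^ (2 * N)) sums S"
      using sums_mono_reindex[of "\<lambda>N. 2 * N" "\<lambda>n. weight q n 0 * t ^ n" S] sums
      by (simp add: strict_mono_def)
  qed
  moreover have "G t q = (\<Sum>\<^sub>\<infinity>N. \<Sum>\<^sub>\<infinity>m. G_term t q (N, m))"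
    unfolding G_def using infsum_Sigma'_banach[of "\<lambda>N m. G_term t q (N, m)" UNIV "\<lambda>_. UNIV"] abs
    by (simp add: abs_summable_summable)
  ultimately show "G t q = S"
    unfolding infsumI[OF inner] by (simp add: infsumI)
qed

section \<open>The q-series behind the bounded solution\<close>

text \<open>In q-Pochhammer notation, \<open>(q^(k+1); q)_h / (a*q^(k+1); q)_h\<close>.\<close>

definition qratio :: "complex \<Rightarrow> complex \<Rightarrow> nat \<Rightarrow> nat \<Rightarrow> complex" where
  "qratio a q k h = (\<Prod>j<h. (1 - q ^ Suc (k + j)) / (1 - a * q ^ Suc (k + j)))"

text \<open>Up to the factor \<open>(q; q)_h / (a*q; q)_h\<close>, the 2phi1 series with upper
  parameters \<open>q^(h+1)\<close> and \<open>a*q\<close>, lower parameter \<open>a*q^(h+1)\<close>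
  and argument \<open>-a\<close>.\<close>

definition qseries :: "complex \<Rightarrow> complex \<Rightarrow> nat \<Rightarrow> complex" where
  "qseries a q h = (\<Sum>k. qratio a q k h * (-a) ^ k)"

context
  fixes a q :: complex
  assumes q: "norm q < 1" and a: "norm a \<le> 1 / 4"
begin

lemma norm_one_minus_ge: "3 / 4 \<le> norm (1 - a * q ^ k)"
proof -
  have "norm (a * q ^ k) \<le> 1 / 4 * 1"
    unfolding norm_mult using q a by (intro mult_mono) (auto simp: norm_power power_le_one)
  then show ?thesis using norm_triangle_ineq2[of 1 "a * q ^ k"] by simp
qed

lemma one_minus_nonzero: "1 - a * q ^ k \<noteq> 0"
  using norm_one_minus_ge[of k] by auto

lemma norm_one_minus_power_le: "norm (1 - q ^ k) \<le> 2"
  using norm_triangle_ineq4[of 1 "q ^ k"] q power_le_one[of "norm q" k] by (simp add: norm_power)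

text \<open>Each factor is at most \<open>2 / (3 / 4)\<close>, rounded up to 4 so that powers of a
  number of modulus at most \<open>1 / 4\<close> compensate the growth in \<open>h\<close>.\<close>

lemma norm_qratio_le: "norm (qratio a q k h) \<le> 4 ^ h"
proof -
  have "norm ((1 - q ^ Suc (k + j)) / (1 - a * q ^ Suc (k + j))) \<le> 4" for j
  proof -
    have "norm (1 - q ^ Suc (k + j)) / norm (1 - a * q ^ Suc (k + j)) \<le> 2 / (3 / 4)"
      by (intro frac_le norm_one_minus_power_le norm_one_minus_ge) auto
    also have "\<dots> \<le> 4" by simp
    finally show ?thesis unfolding norm_divide .
  qed
  then have "norm (qratio a q k h) \<le> (\<Prod>j<h. 4)"
    unfolding qratio_def prod_norm[symmetric] by (intro prod_mono) auto
  then show ?thesis by simp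
qed

lemma qratio_Suc:
  "qratio a q k (Suc h) = qratio a q k h * ((1 - q ^ Suc (k + h)) / (1 - a * q ^ Suc (k + h)))"
  by (simp add: qratio_def)

lemma qratio_Suc_left:
  "(1 - q ^ Suc k) * qratio a q (Suc k) h = (1 - a * q ^ Suc k) * qratio a q k (Suc h)"
  using one_minus_nonzero[of "Suc k"] unfolding qratio_def prod.lessThan_Suc_shift by simp

lemma norm_qseries_term_le: "norm (qratio a q k h * (-a) ^ k) \<le> 4 ^ h * (1 / 4) ^ k"
  unfolding norm_mult norm_power norm_minus_cancel
  by (intro mult_mono norm_qratio_le power_mono a) auto

lemma summable_bound: "summable (\<lambda>k. 4 ^ h * (1 / 4 :: real) ^ k)"
  by (intro summable_mult summable_geometric) simp

lemma qseries_sums: "(\<lambda>k. qratio a q k h * (-a) ^ k) sums qseries a q h"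
  unfolding qseries_def
  by (rule summable_sums, rule summable_comparison_test'[OF summable_bound])
    (rule norm_qseries_term_le)

lemma norm_qseries_le: "norm (qseries a q h) \<le> 4 ^ h * (4 / 3)"
proof -
  have "norm (qseries a q h) \<le> (\<Sum>k. 4 ^ h * (1 / 4) ^ k)"
    unfolding qseries_def by (intro norm_suminf_le norm_qseries_term_le summable_bound)
  also have "\<dots> = 4 ^ h * (4 / 3)"
    by (subst suminf_mult) (auto simp: suminf_geometric)
  finally show ?thesis .
qed

text \<open>Termwise in \<open>k\<close>, the two sides differ by \<open>T (Suc k) - T k\<close> for
  a sequence \<open>T\<close> with \<open>T 0 = 0\<close> and limit 0. For
  \<open>a = \<i> * l\<close>, where \<open>a\<^sup>2 = - l\<^sup>2\<close>, scaling by powers of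
  \<open>l\<close> turns this into the height recurrence.\<close>

lemma qseries_recurrence:
  "(1 - a\<^sup>2) * qseries a q (Suc h) =
     (1 - q ^ Suc h) * (qseries a q h - a\<^sup>2 * qseries a q (Suc (Suc h)))"
proof -
  \<comment> \<open>\<open>T\<close> is the Gosper certificate: its differences are the terms of the recurrence.\<close>
  define T where "T k = - ((-a) ^ k * qratio a q k h * (1 - q ^ k) * q ^ Suc h * (1 - a)
      / (1 - a * q ^ Suc (k + h)))" for k
  define C where "C = 4 ^ h * 2 * 1 * norm (1 - a) / (3 / 4)"
  have "norm (T k) \<le> C * norm a ^ k" for k
  proof -
    have "norm (T k) = norm (qratio a q k h) * norm (1 - q ^ k) * norm (q ^ Suc h) * norm (1 - a)
        / norm (1 - a * q ^ Suc (k + h)) * norm a ^ k"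
      by (simp add: T_def norm_mult norm_divide norm_power)
    also have "\<dots> \<le> C * norm a ^ k"
      unfolding C_def
      by (intro mult_right_mono frac_le mult_mono norm_qratio_le norm_one_minus_power_le
          norm_one_minus_ge) (use q in \<open>auto simp: norm_power power_le_one simp del: power_Suc\<close>)
    finally show ?thesis .
  qed
  then have "\<forall>\<^sub>F k in sequentially. norm (T k) \<le> C * norm a ^ k"
    by (intro always_eventually allI)
  moreover have "(\<lambda>k. C * norm a ^ k) \<longlonglongrightarrow> C * 0"
    by (intro tendsto_intros LIMSEQ_power_zero) (use a in auto)
  then have "(\<lambda>k. C * norm a ^ k) \<longlonglongrightarrow> 0"
    by (simp only: mult_zero_right)
  ultimately have "T \<longlonglongrightarrow> 0"
    by (rule Lim_null_comparison)
  \<comment> \<open>The telescoped sum is \<open>- T 0\<close>, which vanishes through the factor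
    \<open>1 - q ^ 0\<close>.\<close>
  from telescope_sums[OF this] have "(\<lambda>k. T (Suc k) - T k) sums 0"
    by (simp add: T_def)
  moreover have "T (Suc k) - T k =
      (1 - a\<^sup>2) * (qratio a q k (Suc h) * (-a) ^ k)
      - (1 - q ^ Suc h) * (qratio a q k h * (-a) ^ k
          - a\<^sup>2 * (qratio a q k (Suc (Suc h)) * (-a) ^ k))" for k
  proof -
    \<comment> \<open>Treating \<open>q ^ k\<close> and \<open>q ^ Suc h\<close> as independent
      variables and splitting off the common \<open>p\<close> leaves a rational identity in
      \<open>a\<close>, \<open>q\<close>, \<open>x\<close>, \<open>y\<close>.\<close>
    define x y p where "x = q ^ k" and "y = q ^ Suc h" and "p = qratio a q k h"
    have nz: "1 - a * (x * y) \<noteq> 0" "1 - a * (x * y * q) \<noteq> 0"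
      using one_minus_nonzero[of "Suc (k + h)"] one_minus_nonzero[of "Suc (Suc (k + h))"]
      by (simp_all add: x_def y_def power_add mult_ac)
    have e: "q ^ Suc (k + h) = x * y" "q ^ Suc (k + Suc h) = x * y * q" "q ^ Suc (Suc k + h) = x * y * q"
      by (simp_all add: x_def y_def power_add mult_ac)
    have p1: "qratio a q k (Suc h) = p * ((1 - x * y) / (1 - a * (x * y)))"
      unfolding qratio_Suc e p_def ..
    have p2: "qratio a q k (Suc (Suc h)) = p * ((1 - x * y) / (1 - a * (x * y))) *
        ((1 - x * y * q) / (1 - a * (x * y * q)))"
      unfolding qratio_Suc[of k "Suc h"] p1 e ..
    have "T (Suc k) = a * (-a) ^ k * ((1 - q ^ Suc k) * qratio a q (Suc k) h) * y * (1 - a)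
        / (1 - a * (x * y * q))"
      unfolding T_def e y_def by simp
    also have "\<dots> = a * (-a) ^ k * ((1 - a * (x * q)) * (p * ((1 - x * y) / (1 - a * (x * y))))) * y * (1 - a)
        / (1 - a * (x * y * q))"
      unfolding qratio_Suc_left p1 by (simp add: x_def mult_ac)
    finally have T1: "T (Suc k) = \<dots>" .
    have T0: "T k = - ((-a) ^ k * p * (1 - x) * y * (1 - a) / (1 - a * (x * y)))"
      unfolding T_def e y_def p_def x_def by simp
    have "a * ((1 - a * (x * q)) * ((1 - x * y) / (1 - a * (x * y)))) * y * (1 - a) / (1 - a * (x * y * q))
        + (1 - x) * y * (1 - a) / (1 - a * (x * y)) =
        (1 - a\<^sup>2) * ((1 - x * y) / (1 - a * (x * y)))
      - (1 - y) * (1 - a\<^sup>2 * ((1 - x * y) / (1 - a * (x * y)) * ((1 - x * y * q) / (1 - a * (x * y * q)))))"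
      (is "?L = ?R")
    proof -
      define u v where "u = 1 - a * (x * y)" and "v = 1 - a * (x * y * q)"
      have "u \<noteq> 0" "v \<noteq> 0" using nz by (simp_all add: u_def v_def)
      moreover have "a * (1 - a * (x * q)) * (1 - x * y) * y * (1 - a) + (1 - x) * y * (1 - a) * v =
          (1 - a\<^sup>2) * (1 - x * y) * v
          - (1 - y) * (u * v - a\<^sup>2 * (1 - x * y) * (1 - x * y * q))"
        unfolding u_def v_def by (simp add: algebra_simps power2_eq_square)
      ultimately show ?thesis
        unfolding u_def[symmetric] v_def[symmetric]
        by (simp add: divide_simps) (simp add: algebra_simps)
    qed
    then have "(-a) ^ k * p * ?L = (-a) ^ k * p * ?R" by simp
    then show ?thesis
      unfolding T1 T0 p1 p2 p_def[symmetric] y_def[symmetric] by (simp add: algebra_simps)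
  qed
  ultimately have "(\<lambda>k. (1 - a\<^sup>2) * (qratio a q k (Suc h) * (-a) ^ k)
      - (1 - q ^ Suc h) * (qratio a q k h * (-a) ^ k
          - a\<^sup>2 * (qratio a q k (Suc (Suc h)) * (-a) ^ k))) sums 0"
    by simp
  moreover have "(\<lambda>k. (1 - a\<^sup>2) * (qratio a q k (Suc h) * (-a) ^ k)
      - (1 - q ^ Suc h) * (qratio a q k h * (-a) ^ k
          - a\<^sup>2 * (qratio a q k (Suc (Suc h)) * (-a) ^ k))) sums
      ((1 - a\<^sup>2) * qseries a q (Suc h)
       - (1 - q ^ Suc h) * (qseries a q h - a\<^sup>2 * qseries a q (Suc (Suc h))))"
    by (intro sums_diff sums_mult qseries_sums)
  ultimately have "0 = (1 - a\<^sup>2) * qseries a q (Suc h)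
       - (1 - q ^ Suc h) * (qseries a q h - a\<^sup>2 * qseries a q (Suc (Suc h)))"
    by (rule sums_unique2)
  then show ?thesis by simp
qed

text \<open>The products are empty, leaving a geometric series. This value supplies the
  inhomogeneous term at height 0.\<close>

lemma qseries_0: "qseries a q 0 = 1 / (1 + a)"
proof -
  have "norm (-a) < 1" using a by simp
  from suminf_geometric[OF this] show ?thesis by (simp add: qseries_def qratio_def)
qed

lemma lambert_summable: "summable (\<lambda>k. (-a) ^ k / (1 - a * q ^ k))"
proof (rule summable_comparison_test'[of "\<lambda>k. 2 * (1 / 4) ^ k"])
  show "summable (\<lambda>k. 2 * (1 / 4 :: real) ^ k)"
    by (intro summable_mult summable_geometric) simp
  show "norm ((-a) ^ k / (1 - a * q ^ k)) \<le> 2 * (1 / 4) ^ k" for k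
  proof -
    have "norm a ^ k / norm (1 - a * q ^ k) \<le> (1 / 4) ^ k / (3 / 4)"
      by (intro frac_le power_mono a norm_one_minus_ge) auto
    also have "\<dots> \<le> 2 * (1 / 4) ^ k" by simp
    finally show ?thesis by (simp add: norm_divide norm_power)
  qed
qed

text \<open>With \<open>x = q ^ Suc k\<close>, the partial fraction
  \<open>(1 - x) / (1 - a * x) = (1 - (1 - a) / (1 - a * x)) / a\<close> splits the series into a
  geometric one and a shifted Lambert-type one.\<close>

lemma qseries_1:
  assumes "a \<noteq> 0"
  shows "(1 + a) * qseries a q 1 = ((1 - a\<^sup>2) * (\<Sum>k. (-a) ^ k / (1 - a * q ^ k)) - 1) / a\<^sup>2"
proof -
  define S where "S = (\<Sum>k. (-a) ^ k / (1 - a * q ^ k))"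
  have na: "norm (-a) < 1" "1 - a \<noteq> 0" "1 + a \<noteq> 0"
    using a by (auto simp: add_eq_0_iff dest: sym)
  \<comment> \<open>The subtracted \<open>1 / (1 - a)\<close> is the term at
    \<open>k = 0\<close>.\<close>
  have "(\<lambda>k. (-a) ^ Suc k / (1 - a * q ^ Suc k)) sums (S - 1 / (1 - a))"
    using lambert_summable
    by (subst sums_Suc_iff) (simp add: S_def summable_sums)
  then have "(\<lambda>k. - (1 / a) * ((-a) ^ Suc k / (1 - a * q ^ Suc k))) sums (- (1 / a) * (S - 1 / (1 - a)))"
    by (rule sums_mult)
  then have S: "(\<lambda>k. (-a) ^ k / (1 - a * q ^ Suc k)) sums (- (1 / a) * (S - 1 / (1 - a)))"
    using assms by simp
  have "(\<lambda>k. 1 / a * ((-a) ^ k - (1 - a) * ((-a) ^ k / (1 - a * q ^ Suc k)))) sums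
     (1 / a * (1 / (1 - - a) - (1 - a) * (- (1 / a) * (S - 1 / (1 - a)))))"
    by (intro sums_mult sums_diff geometric_sums S na)
  moreover have "1 / a * ((-a) ^ k - (1 - a) * ((-a) ^ k / (1 - a * q ^ Suc k))) =
      qratio a q k 1 * (-a) ^ k" for k
    using one_minus_nonzero[of "Suc k"] assms
    by (simp add: qratio_def divide_simps) (simp add: algebra_simps)
  ultimately have "(\<lambda>k. qratio a q k 1 * (-a) ^ k) sums
      (1 / a * (1 / (1 + a) - (1 - a) * (- (1 / a) * (S - 1 / (1 - a)))))"
    by simp
  from sums_unique2[OF qseries_sums this]
  have "qseries a q 1 = 1 / a * (1 / (1 + a) - (1 - a) * (- (1 / a) * (S - 1 / (1 - a))))" .
  then show ?thesis
    unfolding S_def[symmetric] using assms na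
    by (simp add: divide_simps) algebra
qed

end

section \<open>Identification of the generating function\<close>

lemma generating_function_eq:
  fixes q t l :: complex
  assumes q: "norm q < 1" and t: "2 * norm t < 1 - norm q" "t \<noteq> 0"
    and l: "norm l \<le> 1 / 4" "(1 + l\<^sup>2) * t = l * (1 - q)"
  shows "(\<lambda>n. weight q n 0 * t ^ n) sums ((1 + \<i> * l) * (l / t) * qseries (\<i> * l) q 1)"
proof -
  define a where "a = \<i> * l"
  have a: "norm a \<le> 1 / 4" "a\<^sup>2 = - l\<^sup>2" using l by (simp_all add: a_def norm_mult power_mult_distrib)
  have na: "1 + a \<noteq> 0" using a by (auto simp: add_eq_0_iff dest: sym)
  have q1: "1 - q \<noteq> 0" using q by auto
  define D where "D = qseries a q"
  define b where "b = (1 + a) / t"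
  \<comment> \<open>The index of \<open>D\<close> is shifted by one so that \<open>D 0\<close>
    stands for height -1; \<open>b\<close> is normalised to give
    \<open>b * D 0 = 1 / t\<close>.\<close>
  define f where "f h = b * (l ^ Suc h * D (Suc h))" for h
  define B where "B = norm b * (4 / 3)"
  have "(\<lambda>n. weight q n 0 * t ^ n) sums f 0"
  proof (rule weight_sums_bounded_solution[OF q t(1)])
    show "norm (f h) \<le> B" for h
    proof -
      have "norm (l ^ Suc h * D (Suc h)) \<le> (1 / 4) ^ Suc h * (4 ^ Suc h * (4 / 3))"
        unfolding D_def norm_mult norm_power using l
        by (intro mult_mono power_mono norm_qseries_le q a) auto
      also have "\<dots> = 4 / 3" by (simp add: power_divide)
      finally show ?thesis
        unfolding f_def B_def norm_mult by (intro mult_left_mono) auto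
    qed
    show "f h = (if h = 0 then 1 else 0) +
              t * (\<Sum>s\<le>h. q ^ s) * (f (Suc h) + (if h = 0 then 0 else f (h - 1)))" for h
    proof -
      have gp: "(\<Sum>s\<le>h. q ^ s) = (1 - q ^ Suc h) / (1 - q)"
        using q1 by (simp add: sum_gp0)
      have rec: "(1 + l\<^sup>2) * D (Suc h) = (1 - q ^ Suc h) * (D h + l\<^sup>2 * D (Suc (Suc h)))"
        using qseries_recurrence[OF q a(1), of h] by (simp add: a D_def)
      have "(1 - q) * f h = b * l ^ h * ((l * (1 - q)) * D (Suc h))"
        by (simp add: f_def)
      also have "\<dots> = b * l ^ h * (t * ((1 + l\<^sup>2) * D (Suc h)))"
        unfolding l(2)[symmetric] by (simp add: mult_ac)
      also have "\<dots> = t * (1 - q ^ Suc h) * (f (Suc h) + b * (l ^ h * D h))"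
        unfolding rec f_def by (simp add: algebra_simps power2_eq_square)
      \<comment> \<open>The last summand is \<open>f (h - 1)\<close> for positive \<open>h\<close>;
        for \<open>h = 0\<close> it is \<open>1 / t\<close>, which yields the inhomogeneous term
        1.\<close>
      finally have main: "f h = t * (\<Sum>s\<le>h. q ^ s) * (f (Suc h) + b * (l ^ h * D h))"
        unfolding gp using q1 by (simp add: field_simps)
      show ?thesis
      proof (cases h)
        case 0
        have "D 0 = 1 / (1 + a)" unfolding D_def by (rule qseries_0[OF q a(1)])
        then have "b * D 0 = 1 / t" using na by (simp add: b_def)
        then show ?thesis using main t(2) by (simp add: 0 distrib_left)
      next
        case (Suc j)
        then show ?thesis using main by (simp add: f_def)
      qed
    qed
  qed
  then show ?thesis by (simp add: f_def b_def D_def a_def mult_ac)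
qed

section \<open>The root of smallest modulus\<close>

text \<open>The roots have product 1, so some root \<open>l\<close> has modulus at most 1. Then
  \<open>l * c = 1 + l\<^sup>2\<close> bounds \<open>norm l\<close> by \<open>2 / norm c\<close>,
  which the constant 8 makes smaller than \<open>1 / 4\<close>.\<close>

lemma exists_smallest_root:
  fixes q t :: complex
  assumes t: "t \<noteq> 0" and c: "8 * norm t < norm (1 - q)"
  shows "\<exists>l. smallest_root t q l \<and> l \<noteq> 0 \<and> norm l \<le> 1 / 4"
proof -
  define c where "c = (1 - q) / t"
  have c8: "8 < norm c" using assms by (simp add: c_def norm_divide field_simps)
  have roots: "z\<^sup>2 - z * (1 - q) / t + 1 = 0 \<longleftrightarrow> z\<^sup>2 - z * c + 1 = 0" for z
    by (simp add: c_def)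
  define z where "z = (c + csqrt (c\<^sup>2 - 4)) / 2"
  have z: "z\<^sup>2 - z * c + 1 = 0"
  proof -
    have "(csqrt (c\<^sup>2 - 4))\<^sup>2 = c\<^sup>2 - 4" by simp
    moreover have "csqrt (c\<^sup>2 - 4) = 2 * z - c" by (simp add: z_def field_simps)
    ultimately have "(2 * z - c)\<^sup>2 = c\<^sup>2 - 4" by simp
    then have "4 * (z\<^sup>2 - z * c + 1) = 0" by algebra
    then show ?thesis by (simp only: mult_eq_0_iff) simp
  qed
  have z0: "z \<noteq> 0" using z by auto
  have zi: "(1 / z)\<^sup>2 - (1 / z) * c + 1 = 0"
    using z z0 by (simp add: field_simps power2_eq_square)
  obtain l where l: "l\<^sup>2 - l * c + 1 = 0" "l \<noteq> 0" "norm l \<le> 1"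
  proof (cases "norm z \<le> 1")
    case True
    then show ?thesis using that z z0 by blast
  next
    case False
    then have "norm (1 / z) \<le> 1" by (auto simp: norm_divide divide_le_eq_1)
    then show ?thesis using that[OF zi] z0 by simp
  qed
  have "l * c = 1 + l\<^sup>2" using l by (simp add: algebra_simps)
  then have "norm l * norm c \<le> 1 + (norm l)\<^sup>2"
    by (metis norm_mult norm_one norm_power norm_triangle_ineq)
  also have "\<dots> \<le> 2" using l(3) by (simp add: power_le_one)
  finally have "norm l * norm c \<le> 2" .
  moreover have "norm l * 8 \<le> norm l * norm c" using c8 by (intro mult_left_mono) auto
  ultimately have "norm l * 8 \<le> 2" by linarith
  then have l4: "norm l \<le> 1 / 4" by simp
  have "norm l < norm l'" if "l'\<^sup>2 - l' * c + 1 = 0" "l' \<noteq> l" for l'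
  proof -
    \<comment> \<open>The quadratic factors with roots \<open>l\<close> and \<open>1 / l\<close>, so
      the other root has modulus \<open>1 / norm l\<close>.\<close>
    have "(l' - l) * (l' - 1 / l) = 0"
      using that(1) l(1,2) by (simp add: field_simps power2_eq_square) algebra
    then have "norm l' = 1 / norm l" using that(2) by (simp add: norm_divide)
    moreover have "norm l < 1 / norm l"
    proof -
      have "norm l * norm l \<le> 1 / 4 * (1 / 4)" by (intro mult_mono l4) auto
      then show ?thesis using l(2) by (simp add: pos_less_divide_eq)
    qed
    ultimately show ?thesis by simp
  qed
  then show ?thesis
    unfolding smallest_root_def roots using l l4 by blast
qed

theorem corollary1p3:
  fixes q :: complex
  assumes "norm q < 1"
  shows "\<exists>r>0. \<forall>t::complex. t \<noteq> 0 \<and> norm t < r \<longrightarrow>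
    G_term t q summable_on UNIV \<and>
    (\<exists>l. smallest_root t q l \<and>
         summable (\<lambda>k. (- \<i> * l) ^ k / (1 - \<i> * l * q ^ k)) \<and>
         G t q = (1 + l\<^sup>2) * (1 - (1 + l\<^sup>2) * (\<Sum>k. (- \<i> * l) ^ k / (1 - \<i> * l * q ^ k)))
                 / (l\<^sup>2 * (1 - q)))"
\<comment> \<open>This radius gives \<open>8 * norm t < norm (1 - q)\<close>, hence
  \<open>norm l \<le> 1 / 4\<close>, and also the contraction condition
  \<open>2 * norm t < 1 - norm q\<close>.\<close>
proof (intro exI[of _ "(1 - norm q) / 8"] conjI allI impI)
  show "(1 - norm q) / 8 > 0" using assms by simp
next
  fix t :: complex
  assume "t \<noteq> 0 \<and> norm t < (1 - norm q) / 8"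
  then have t: "t \<noteq> 0" "8 * norm t < 1 - norm q" by auto
  then have t2: "2 * norm t < 1 - norm q" using norm_ge_zero[of t] by linarith
  have "8 * norm t < norm (1 - q)" using t norm_triangle_ineq2[of 1 q] by simp
  from exists_smallest_root[OF t(1) this] obtain l
    where l: "smallest_root t q l" "l \<noteq> 0" "norm l \<le> 1 / 4" by blast
  have q1: "1 - q \<noteq> 0" using assms by auto
  have lt: "(1 + l\<^sup>2) * t = l * (1 - q)"
    using l(1) t(1) by (simp add: smallest_root_def field_simps)
  have nl: "norm (\<i> * l) \<le> 1 / 4" "\<i> * l \<noteq> 0" using l by (simp_all add: norm_mult)
  note sums = generating_function_eq[OF assms t2 t(1) l(3) lt]
  show "G_term t q summable_on UNIV" by (rule G_term_has_sum(1)[OF assms t2 sums])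
  define S where "S = (\<Sum>k. (- \<i> * l) ^ k / (1 - \<i> * l * q ^ k))"
  have "G t q = l / t * ((1 + \<i> * l) * qseries (\<i> * l) q 1)"
    using G_term_has_sum(2)[OF assms t2 sums] by (simp add: mult_ac)
  also have "\<dots> = l / t * (((1 - (\<i> * l)\<^sup>2) * S - 1) / (\<i> * l)\<^sup>2)"
    unfolding qseries_1[OF assms nl] S_def by simp
  also have "((1 - (\<i> * l)\<^sup>2) * S - 1) / (\<i> * l)\<^sup>2 = (1 - (1 + l\<^sup>2) * S) / l\<^sup>2"
    using l(2) by (simp add: power_mult_distrib field_simps)
  \<comment> \<open>The quadratic equation eliminates \<open>t\<close> from the prefactor.\<close>
  also have "l / t = (1 + l\<^sup>2) / (1 - q)"
    using lt t(1) q1 by (simp add: field_simps)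
  finally have "G t q = (1 + l\<^sup>2) * (1 - (1 + l\<^sup>2) * S) / (l\<^sup>2 * (1 - q))"
    by (simp add: mult_ac)
  then show "\<exists>l. smallest_root t q l \<and>
         summable (\<lambda>k. (- \<i> * l) ^ k / (1 - \<i> * l * q ^ k)) \<and>
         G t q = (1 + l\<^sup>2) * (1 - (1 + l\<^sup>2) * (\<Sum>k. (- \<i> * l) ^ k / (1 - \<i> * l * q ^ k)))
                 / (l\<^sup>2 * (1 - q))"
    using l(1) lambert_summable[OF assms nl(1)] unfolding S_def by auto
qed

end
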